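(* Let $n\ge 3$ and let $*:(\mathcal{Z}^n_s)^2\to\mathcal{Z}^n_s$ be an operation on the class $\mathcal{Z}^n_s$ of $o$-symmetric zonoids in $\mathbb{R}^n$. Then $*$ is continuous in the Hausdorff metric, $GL(n)$ covariant, and has the identity property if and only if it is Minkowski addition, i.e., $K*L=K+L$ for all $K,L\in\mathcal{Z}^n_s$.
   Context: A zonotope is a finite Minkowski sum of line segments in $\mathbb{R}^n$; a zonoid is a limit in the Hausdorff metric of zonotopes. $\mathcal{Z}^n_s$ is the class of $o$-symmetric ($K=-K$) zonoids in $\mathbb{R}^n$; these need not have nonempty interior. Minkowski addition is $X+Y=\{x+y:x\in X,\ y\in Y\}$. Continuity in the Hausdorff metric means: if $K_m\to M$ and $L_m\to N$ in the Hausdorff metric as $m\to\infty$, with all sets in $\mathcal{Z}^n_s$, then $K_m*L_m\to M*N$. The operation $*$ is $GL(n)$ covariant if $\phi(K*L)=\phi K*\phi L$ for all $\phi\in GL(n)$ and all $K,L\in\mathcal{Z}^n_s$. It has the identity property if $K*\{o\}=K=\{o\}*K$ for all $K\in\mathcal{Z}^n_s$, where $o$ is the origin. *)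

theory Defs
  imports "HOL-Analysis.Analysis"
begin

text \<open>Minkowski addition is the library's \<open>+\<close> on sets (\<open>HOL-Library.Set_Algebras\<close>), and
  finite Minkowski sums are the corresponding \<open>\<Sum>\<close>.\<close>

text \<open>The suprema are over reals, so the formula is meaningful for nonempty bounded sets only;
  below it is applied to nonempty compact sets.\<close>

definition hausdorff_dist :: "'a::metric_space set \<Rightarrow> 'a set \<Rightarrow> real" where
  "hausdorff_dist K L = max (SUP x\<in>K. infdist x L) (SUP y\<in>L. infdist y K)"

definition hausdorff_lim :: "(nat \<Rightarrow> 'a::metric_space set) \<Rightarrow> 'a set \<Rightarrow> bool" where
  "hausdorff_lim K M \<longleftrightarrow> (\<lambda>m. hausdorff_dist (K m) M) \<longlonglongrightarrow> 0"

text \<open>Segments may be degenerate; the empty sum is \<open>{0}\<close>, itself a degenerate segment.\<close>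

definition zonotope :: "'a::real_vector set \<Rightarrow> bool" where
  "zonotope Z \<longleftrightarrow> (\<exists>(m::nat) a b. Z = (\<Sum>i<m. closed_segment (a i) (b i)))"

text \<open>The limit is taken in the space of nonempty compact sets, on which
  \<open>hausdorff_dist\<close> is a metric; convexity of the limit is then automatic.\<close>

definition zonoid :: "'a::real_normed_vector set \<Rightarrow> bool" where
  "zonoid K \<longleftrightarrow> K \<noteq> {} \<and> compact K \<and> (\<exists>Z. (\<forall>m. zonotope (Z m)) \<and> hausdorff_lim Z K)"

definition sym_zonoids :: "'a::real_normed_vector set set" where
  "sym_zonoids = {K. zonoid K \<and> uminus ` K = K}"

definition hausdorff_continuous_op ::
  "('a::real_normed_vector set \<Rightarrow> 'a set \<Rightarrow> 'a set) \<Rightarrow> bool" where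
  "hausdorff_continuous_op f \<longleftrightarrow>
    (\<forall>K L M N. (\<forall>m. K m \<in> sym_zonoids) \<and> (\<forall>m. L m \<in> sym_zonoids) \<and>
       M \<in> sym_zonoids \<and> N \<in> sym_zonoids \<and> hausdorff_lim K M \<and> hausdorff_lim L N \<longrightarrow>
       hausdorff_lim (\<lambda>m. f (K m) (L m)) (f M N))"

definition GL_covariant_op ::
  "((real^'n) set \<Rightarrow> (real^'n) set \<Rightarrow> (real^'n) set) \<Rightarrow> bool" where
  "GL_covariant_op f \<longleftrightarrow>
    (\<forall>A :: real^'n^'n. invertible A \<longrightarrow>
      (\<forall>K\<in>sym_zonoids. \<forall>L\<in>sym_zonoids. (*v) A ` f K L = f ((*v) A ` K) ((*v) A ` L)))"

definition identity_property_op ::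
  "('a::real_normed_vector set \<Rightarrow> 'a set \<Rightarrow> 'a set) \<Rightarrow> bool" where
  "identity_property_op f \<longleftrightarrow> (\<forall>K\<in>sym_zonoids. f K {0} = K \<and> f {0} K = K)"

end

theory Submission
  imports Defs
begin

text \<open>Rank-one maps are limits of invertible ones, so continuity and covariance give
  \<open>h(f K L) = F(h K, h L)\<close> on support functions \<open>h\<close> for some \<open>F\<close> on the positive quadrant, and the
  identity property gives \<open>F s 0 = s\<close>, \<open>F 0 t = t\<close>. With \<open>K\<close> a square spanned by \<open>e1, e2\<close> and \<open>L\<close> a
  segment along \<open>e3\<close>, \<open>F (\<bar>a\<bar> + \<bar>b\<bar>) \<bar>c\<bar>\<close> is the support function of a zonoid. Where \<open>F\<close> is
  differentiable, the face of this zonoid with outer normal \<open>(s, 0, t)\<close> is a segment parallel to \<open>e2\<close>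
  of half-length \<open>F\<^sub>s s t\<close>, so the generating measure has an atom at \<open>e2\<close> whose mass determines
  \<open>F\<^sub>s s t\<close>. Hence \<open>F\<^sub>s\<close> is constant, and \<open>F s t = s + t\<close>. Integral representations and derivatives
  are avoided by an inequality between second differences that holds for all zonoids.\<close>

section \<open>Hausdorff limits of compact sets\<close>

lemma compact_set_plus:
  fixes A B :: "'a::real_normed_vector set"
  assumes "compact A" "compact B"
  shows "compact (A + B)"
proof -
  have "continuous_on (A \<times> B) (\<lambda>z. fst z + snd z)" by (intro continuous_intros)
  then have "compact ((\<lambda>z. fst z + snd z) ` (A \<times> B))"
    by (intro compact_continuous_image compact_Times assms)
  then show ?thesis by (simp add: set_plus_image case_prod_unfold)
qed

lemma image_set_plus:
  assumes "\<And>x y. g (x + y) = g x + g y"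
  shows "g ` (A + B) = g ` A + g ` B"
proof (intro equalityI subsetI)
  fix z assume "z \<in> g ` A + g ` B"
  then obtain x y where "x \<in> A" "y \<in> B" "z = g (x + y)"
    by (auto elim!: set_plus_elim simp: assms)
  then show "z \<in> g ` (A + B)" by (simp add: set_plus_intro)
qed (auto elim!: set_plus_elim simp: assms set_plus_intro)

text \<open>Compactness makes each distance to a set attained and the suprema finite, so a bound on
  the metric becomes a pointwise statement with the same \<open>e\<close>.\<close>

lemma hausdorff_dist_le_iff:
  fixes K L :: "'a::metric_space set"
  assumes "compact K" "K \<noteq> {}" "compact L" "L \<noteq> {}"
  shows "hausdorff_dist K L \<le> e \<longleftrightarrow>
    (\<forall>x\<in>K. \<exists>y\<in>L. dist x y \<le> e) \<and> (\<forall>y\<in>L. \<exists>x\<in>K. dist x y \<le> e)"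
proof -
  have *: "(SUP x\<in>A. infdist x B) \<le> e \<longleftrightarrow> (\<forall>x\<in>A. \<exists>y\<in>B. dist x y \<le> e)"
    if A: "compact A" "A \<noteq> {}" and B: "compact B" "B \<noteq> {}" for A B :: "'a set"
  proof -
    have "compact ((\<lambda>x. infdist x B) ` A)"
      by (intro compact_continuous_image continuous_intros A)
    then have bdd: "bdd_above ((\<lambda>x. infdist x B) ` A)"
      by (intro bounded_imp_bdd_above compact_imp_bounded)
    have "infdist x B \<le> e \<longleftrightarrow> (\<exists>y\<in>B. dist x y \<le> e)" for x
    proof
      assume le: "infdist x B \<le> e"
      have "continuous_on B (\<lambda>y. dist x y)" by (intro continuous_intros)
      then obtain y where y: "y \<in> B" "\<And>z. z \<in> B \<Longrightarrow> dist x y \<le> dist x z"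
        using continuous_attains_inf[OF B] by blast
      then have "dist x y \<le> infdist x B"
        by (auto simp: infdist_notempty[OF B(2)] intro!: cINF_greatest B(2))
      with le y(1) show "\<exists>y\<in>B. dist x y \<le> e" by force
    qed (auto intro: infdist_le2)
    then show ?thesis
      by (simp add: cSUP_le_iff[OF A(2) bdd])
  qed
  show ?thesis
    unfolding hausdorff_dist_def max.bounded_iff using assms
    by (simp add: * dist_commute)
qed

lemma hausdorff_lim_iff:
  fixes K :: "nat \<Rightarrow> 'a::metric_space set"
  assumes K: "\<And>m. compact (K m)" "\<And>m. K m \<noteq> {}" and M: "compact M" "M \<noteq> {}"
  shows "hausdorff_lim K M \<longleftrightarrow>
    (\<forall>e>0. \<forall>\<^sub>F m in sequentially.
      (\<forall>x\<in>K m. \<exists>y\<in>M. dist x y \<le> e) \<and> (\<forall>y\<in>M. \<exists>x\<in>K m. dist x y \<le> e))"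
proof -
  have nonneg: "hausdorff_dist (K m) M \<ge> 0" for m
  proof -
    obtain x where "x \<in> K m" using K(2)[of m] by blast
    moreover have "hausdorff_dist (K m) M \<le> hausdorff_dist (K m) M" ..
    ultimately obtain y where "dist x y \<le> hausdorff_dist (K m) M"
      using hausdorff_dist_le_iff[OF K(1)[of m] K(2)[of m] M] by blast
    then show ?thesis using zero_le_dist[of x y] by linarith
  qed
  have "hausdorff_lim K M \<longleftrightarrow>
      (\<forall>e>0. \<forall>\<^sub>F m in sequentially. hausdorff_dist (K m) M < e)"
    by (simp add: hausdorff_lim_def tendsto_iff dist_real_def nonneg)
  also have "\<dots> \<longleftrightarrow> (\<forall>e>0. \<forall>\<^sub>F m in sequentially. hausdorff_dist (K m) M \<le> e)"
  proof (intro iffI allI impI)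
    fix e :: real
    assume "\<forall>e>0. \<forall>\<^sub>F m in sequentially. hausdorff_dist (K m) M \<le> e" "e > 0"
    then have "\<forall>\<^sub>F m in sequentially. hausdorff_dist (K m) M \<le> e/2"
      by (meson half_gt_zero)
    then show "\<forall>\<^sub>F m in sequentially. hausdorff_dist (K m) M < e"
      by eventually_elim (use \<open>e > 0\<close> in linarith)
  qed (auto elim!: eventually_mono)
  finally show ?thesis
    by (simp add: hausdorff_dist_le_iff K M)
qed

lemma hausdorff_lim_image:
  fixes K :: "nat \<Rightarrow> 'a::real_normed_vector set" and g :: "'a \<Rightarrow> 'b::real_normed_vector"
  assumes K: "\<And>m. compact (K m)" "\<And>m. K m \<noteq> {}" and M: "compact M" "M \<noteq> {}"
    and g: "bounded_linear g" and lim: "hausdorff_lim K M"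
  shows "hausdorff_lim (\<lambda>m. g ` K m) (g ` M)"
proof -
  have cont: "continuous_on A g" for A
    by (rule linear_continuous_on[OF g])
  obtain B where B: "B > 0" "\<And>x. norm (g x) \<le> norm x * B"
    using bounded_linear.pos_bounded[OF g] by blast
  have dist: "dist (g x) (g y) \<le> e" if "dist x y \<le> e / B" for x y e
    using B(2)[of "x - y"] that B(1)
    by (simp add: dist_norm linear_diff[OF bounded_linear.linear[OF g]] field_simps)
  show ?thesis
    unfolding hausdorff_lim_iff[OF compact_continuous_image[OF cont K(1)] _
        compact_continuous_image[OF cont M(1)], simplified, OF K(2) M(2)]
  proof (intro allI impI)
    fix e :: real assume "e > 0"
    then have "\<forall>\<^sub>F m in sequentially. (\<forall>x\<in>K m. \<exists>y\<in>M. dist x y \<le> e / B) \<and>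
        (\<forall>y\<in>M. \<exists>x\<in>K m. dist x y \<le> e / B)"
      using lim B(1) unfolding hausdorff_lim_iff[OF K M] by simp
    then show "\<forall>\<^sub>F m in sequentially. (\<forall>x\<in>K m. \<exists>y\<in>M. dist (g x) (g y) \<le> e) \<and>
        (\<forall>y\<in>M. \<exists>x\<in>K m. dist (g x) (g y) \<le> e)"
      by eventually_elim (meson dist)
  qed
qed

lemma hausdorff_lim_plus:
  fixes K L :: "nat \<Rightarrow> 'a::real_normed_vector set"
  assumes K: "\<And>m. compact (K m)" "\<And>m. K m \<noteq> {}" and M: "compact M" "M \<noteq> {}"
    and L: "\<And>m. compact (L m)" "\<And>m. L m \<noteq> {}" and N: "compact N" "N \<noteq> {}"
    and lim: "hausdorff_lim K M" "hausdorff_lim L N"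
  shows "hausdorff_lim (\<lambda>m. K m + L m) (M + N)"
proof -
  have ne: "A + B \<noteq> {}" if "A \<noteq> {}" "B \<noteq> {}" for A B :: "'a set"
    using that by (auto simp: set_plus_def)
  have dist: "dist (x + y) (x' + y') \<le> e" if "dist x x' \<le> e/2" "dist y y' \<le> e/2"
    for x y x' y' :: 'a and e
    using dist_triangle_add[of x y x' y'] that by linarith
  show ?thesis
    unfolding hausdorff_lim_iff[OF compact_set_plus[OF K(1) L(1)] ne[OF K(2) L(2)]
        compact_set_plus[OF M(1) N(1)] ne[OF M(2) N(2)]]
  proof (intro allI impI)
    fix e :: real assume "e > 0"
    then have "e/2 > 0" by simp
    then have "\<forall>\<^sub>F m in sequentially. (\<forall>x\<in>K m. \<exists>y\<in>M. dist x y \<le> e/2) \<and>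
        (\<forall>y\<in>M. \<exists>x\<in>K m. dist x y \<le> e/2)"
      "\<forall>\<^sub>F m in sequentially. (\<forall>x\<in>L m. \<exists>y\<in>N. dist x y \<le> e/2) \<and>
        (\<forall>y\<in>N. \<exists>x\<in>L m. dist x y \<le> e/2)"
      using lim unfolding hausdorff_lim_iff[OF K M] hausdorff_lim_iff[OF L N] by blast+
    then show "\<forall>\<^sub>F m in sequentially. (\<forall>x\<in>K m + L m. \<exists>y\<in>M + N. dist x y \<le> e) \<and>
        (\<forall>y\<in>M + N. \<exists>x\<in>K m + L m. dist x y \<le> e)"
    proof eventually_elim
      case (elim m)
      show ?case
      proof (intro conjI ballI)
        fix z assume "z \<in> K m + L m"
        then obtain x y where "x \<in> K m" "y \<in> L m" "z = x + y" by (rule set_plus_elim)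
        then show "\<exists>y\<in>M + N. dist z y \<le> e"
          using elim dist by (meson set_plus_intro)
      next
        fix z assume "z \<in> M + N"
        then obtain x y where "x \<in> M" "y \<in> N" "z = x + y" by (rule set_plus_elim)
        then show "\<exists>x\<in>K m + L m. dist x z \<le> e"
          using elim dist by (meson set_plus_intro)
      qed
    qed
  qed
qed

text \<open>Matching \<open>h m x\<close> with \<open>g x\<close> settles both directions at once.
  It serves for linear maps that converge to a rank-one map on a fixed zonoid.\<close>

lemma hausdorff_lim_uniform:
  fixes g :: "'a \<Rightarrow> 'b::metric_space"
  assumes K: "\<And>m. compact (h m ` K)" "compact (g ` K)" "K \<noteq> {}"
    and lim: "uniform_limit K h g sequentially"
  shows "hausdorff_lim (\<lambda>m. h m ` K) (g ` K)"
proof -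
  have ne: "h m ` K \<noteq> {}" "g ` K \<noteq> {}" for m using K by auto
  show ?thesis
    unfolding hausdorff_lim_iff[OF K(1) ne(1) K(2) ne(2)]
  proof (intro allI impI)
    fix e :: real assume "e > 0"
    then have "\<forall>\<^sub>F m in sequentially. \<forall>x\<in>K. dist (h m x) (g x) < e"
      using lim by (simp add: uniform_limit_iff)
    then show "\<forall>\<^sub>F m in sequentially. (\<forall>x\<in>h m ` K. \<exists>y\<in>g ` K. dist x y \<le> e) \<and>
        (\<forall>y\<in>g ` K. \<exists>x\<in>h m ` K. dist x y \<le> e)"
      by eventually_elim (auto intro: less_imp_le)
  qed
qed

text \<open>Two points of \<open>M\<close> are approximated in \<open>K m\<close>, combined there by
  convexity, and the result is approximated back in \<open>M\<close>; closedness of \<open>M\<close>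
  finishes. This is how zonoids inherit convexity from zonotopes.\<close>

lemma convex_hausdorff_lim:
  fixes K :: "nat \<Rightarrow> 'a::real_normed_vector set"
  assumes K: "\<And>m. compact (K m)" "\<And>m. K m \<noteq> {}" and M: "compact M" "M \<noteq> {}"
    and lim: "hausdorff_lim K M" and cvx: "\<And>m. convex (K m)"
  shows "convex M"
proof (rule convexI)
  fix x y and u v :: real
  assume xy: "x \<in> M" "y \<in> M" and uv: "0 \<le> u" "0 \<le> v" "u + v = 1"
  let ?z = "u *\<^sub>R x + v *\<^sub>R y"
  have "\<exists>q\<in>M. dist q ?z < e" if "e > 0" for e
  proof -
    have "e/3 > 0" using that by simp
    then have "\<forall>\<^sub>F m in sequentially. (\<forall>x\<in>K m. \<exists>y\<in>M. dist x y \<le> e/3) \<and>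
        (\<forall>y\<in>M. \<exists>x\<in>K m. dist x y \<le> e/3)"
      using lim unfolding hausdorff_lim_iff[OF K M] by blast
    then obtain m where m: "\<forall>x\<in>K m. \<exists>y\<in>M. dist x y \<le> e/3"
        "\<forall>y\<in>M. \<exists>x\<in>K m. dist x y \<le> e/3"
      using eventually_happens'[OF sequentially_bot] by blast
    obtain a b where ab: "a \<in> K m" "dist a x \<le> e/3" "b \<in> K m" "dist b y \<le> e/3"
      using m(2) xy by blast
    have "u *\<^sub>R a + v *\<^sub>R b \<in> K m"
      using cvx[of m] ab uv by (simp add: convex_def)
    then obtain q where q: "q \<in> M" "dist (u *\<^sub>R a + v *\<^sub>R b) q \<le> e/3"
      using m(1) by blast
    have "dist (u *\<^sub>R a + v *\<^sub>R b) ?z \<le> dist (u *\<^sub>R a) (u *\<^sub>R x) + dist (v *\<^sub>R b) (v *\<^sub>R y)"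
      by (rule dist_triangle_add)
    also have "\<dots> = u * dist a x + v * dist b y"
      using uv by (simp add: dist_norm flip: scaleR_diff_right)
    also have "\<dots> \<le> u * (e/3) + v * (e/3)"
      using ab uv by (intro add_mono mult_left_mono) auto
    also have "\<dots> = e/3" using uv by (simp flip: distrib_right)
    finally have "dist q ?z \<le> e/3 + e/3"
      using q(2) dist_triangle3[of q ?z "u *\<^sub>R a + v *\<^sub>R b"] by linarith
    then show ?thesis using q(1) that by force
  qed
  then have "?z \<in> closure M" by (simp add: closure_approachable)
  then show "?z \<in> M" using M(1) by (simp add: compact_imp_closed closure_closed)
qed

section \<open>Support functions\<close>

text \<open>The support function of \<open>K\<close>. The real supremum is meaningful for nonempty
  bounded \<open>K\<close>.\<close>

definition supp :: "'a::euclidean_space set \<Rightarrow> 'a \<Rightarrow> real" where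
  "supp K u = (SUP x\<in>K. u \<bullet> x)"

lemma supp_eqI:
  assumes "x \<in> K" "u \<bullet> x = c" "\<And>y. y \<in> K \<Longrightarrow> u \<bullet> y \<le> c"
  shows "supp K u = c"
  unfolding supp_def by (rule cSup_eq_maximum) (use assms in auto)

lemma supp_attained:
  assumes "compact K" "K \<noteq> {}"
  obtains x where "x \<in> K" "supp K u = u \<bullet> x" "\<And>y. y \<in> K \<Longrightarrow> u \<bullet> y \<le> u \<bullet> x"
proof -
  have "continuous_on K (\<lambda>x. u \<bullet> x)" by (intro continuous_intros)
  from continuous_attains_sup[OF assms this]
  obtain x where "x \<in> K" "\<forall>y\<in>K. u \<bullet> y \<le> u \<bullet> x" by blast
  then show thesis by (intro that[of x] supp_eqI) auto
qed

lemma supp_upper: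
  assumes "compact K" "x \<in> K"
  shows "u \<bullet> x \<le> supp K u"
  using supp_attained[OF assms(1), of u] assms(2) by (metis empty_iff)

lemma supp_scaleR:
  assumes "compact K" "K \<noteq> {}" "c \<ge> 0"
  shows "supp K (c *\<^sub>R u) = c * supp K u"
proof -
  obtain x where "x \<in> K" "supp K u = u \<bullet> x" "\<And>y. y \<in> K \<Longrightarrow> u \<bullet> y \<le> u \<bullet> x"
    using supp_attained[OF assms(1,2)] by metis
  then show ?thesis using assms(3) by (intro supp_eqI[of x]) (auto intro: mult_left_mono)
qed

lemma supp_add_le:
  assumes "compact K" "K \<noteq> {}"
  shows "supp K (u + v) \<le> supp K u + supp K v"
proof -
  obtain x where x: "x \<in> K" "supp K (u + v) = (u + v) \<bullet> x"
    using supp_attained[OF assms] by metis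
  then show ?thesis
    using supp_upper[OF assms(1) x(1), of u] supp_upper[OF assms(1) x(1), of v]
    by (simp add: inner_add_left)
qed

lemma supp_plus:
  assumes "compact K" "K \<noteq> {}" "compact L" "L \<noteq> {}"
  shows "supp (K + L) u = supp K u + supp L u"
proof -
  obtain x where x: "x \<in> K" "supp K u = u \<bullet> x"
    using supp_attained[OF assms(1,2)] by metis
  obtain y where y: "y \<in> L" "supp L u = u \<bullet> y"
    using supp_attained[OF assms(3,4)] by metis
  show ?thesis
  proof (rule supp_eqI)
    show "x + y \<in> K + L" using x y by (simp add: set_plus_intro)
    show "u \<bullet> (x + y) = supp K u + supp L u" using x y by (simp add: inner_add_right)
    show "u \<bullet> z \<le> supp K u + supp L u" if "z \<in> K + L" for z
      using that supp_upper[OF assms(1), of _ u] supp_upper[OF assms(3), of _ u]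
      by (auto elim!: set_plus_elim simp: inner_add_right intro!: add_mono)
  qed
qed

lemma supp_uminus:
  assumes "uminus ` K = K"
  shows "supp K (- u) = supp K u"
proof -
  have "supp K (- u) = (SUP x\<in>K. u \<bullet> (- x))" by (simp add: supp_def)
  also have "\<dots> = (SUP x\<in>uminus ` K. u \<bullet> x)" by (simp only: image_image)
  also have "\<dots> = supp K u" by (simp add: assms supp_def)
  finally show ?thesis .
qed

lemma supp_closed_segment: "supp (closed_segment a b) u = max (u \<bullet> a) (u \<bullet> b)"
proof (rule supp_eqI)
  show "(if u \<bullet> a \<le> u \<bullet> b then b else a) \<in> closed_segment a b" by simp
  show "u \<bullet> (if u \<bullet> a \<le> u \<bullet> b then b else a) = max (u \<bullet> a) (u \<bullet> b)" by simp
  fix y assume "y \<in> closed_segment a b"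
  then obtain s where "0 \<le> s" "s \<le> 1" "y = (1 - s) *\<^sub>R a + s *\<^sub>R b"
    by (auto simp: closed_segment_def)
  then show "u \<bullet> y \<le> max (u \<bullet> a) (u \<bullet> b)"
    using convex_bound_le[of "u \<bullet> a" "max (u \<bullet> a) (u \<bullet> b)" "u \<bullet> b" "1 - s" s]
    by (simp add: inner_add_right)
qed

text \<open>A point of \<open>K\<close> outside \<open>L\<close> could be separated strictly from
  \<open>L\<close>, and the normal of the hyperplane would violate the inequality. Used in both
  directions, this shows that a compact convex set is determined by its support function.\<close>

lemma supp_subset:
  assumes K: "compact K" "K \<noteq> {}" and L: "compact L" "L \<noteq> {}" "convex L"
    and le: "\<And>u. supp K u \<le> supp L u"
  shows "K \<subseteq> L"
proof
  fix x assume x: "x \<in> K"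
  show "x \<in> L"
  proof (rule ccontr)
    assume "x \<notin> L"
    then obtain a b where ab: "a \<bullet> x < b" "\<And>y. y \<in> L \<Longrightarrow> a \<bullet> y > b"
      using separating_hyperplane_closed_point[OF L(3) compact_imp_closed[OF L(1)]] by blast
    \<comment> \<open>\<open>L\<close> lies on the upper side of the hyperplane, so its outer normal
      is \<open>- a\<close>.\<close>
    obtain y where "y \<in> L" "supp L (- a) = (- a) \<bullet> y"
      using supp_attained[OF L(1,2)] by metis
    then show False
      using ab(2)[of y] ab(1) supp_upper[OF K(1) x, of "- a"] le[of "- a"] by simp
  qed
qed

lemma tendsto_supp:
  fixes K :: "nat \<Rightarrow> 'a::euclidean_space set"
  assumes K: "\<And>m. compact (K m)" "\<And>m. K m \<noteq> {}" and M: "compact M" "M \<noteq> {}"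
    and lim: "hausdorff_lim K M"
  shows "(\<lambda>m. supp (K m) u) \<longlonglongrightarrow> supp M u"
proof (rule tendstoI)
  \<comment> \<open>One half of the fact that \<open>supp _ u\<close> is Lipschitz with constant
    \<open>norm u\<close> in the Hausdorff metric; exchanging the sets gives the other half.\<close>
  have le: "supp A u \<le> supp B u + norm u * e"
    if asm: "compact A" "A \<noteq> {}" "compact B" "\<forall>x\<in>A. \<exists>y\<in>B. dist x y \<le> e" for A B :: "'a set" and e
  proof -
    obtain x where x: "x \<in> A" "supp A u = u \<bullet> x"
      using supp_attained[OF asm(1,2)] by metis
    then obtain y where y: "y \<in> B" "dist x y \<le> e" using asm(4) by blast
    have "u \<bullet> x - u \<bullet> y \<le> norm u * norm (x - y)"
      using norm_cauchy_schwarz[of u "x - y"] by (simp add: inner_diff_right)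
    also have "\<dots> \<le> norm u * e" using y by (intro mult_left_mono) (auto simp: dist_norm)
    finally show ?thesis using supp_upper[OF asm(3) y(1), of u] x by linarith
  qed
  fix e :: real assume e: "e > 0"
  define d where "d = e / (2 * (norm u + 1))"
  have d: "d > 0" "norm u * d < e"
  proof -
    have "norm u + 1 > 0" using norm_ge_zero[of u] by linarith
    then show "d > 0" using e by (simp add: d_def)
    have "(norm u + 1) * d = e / 2" using \<open>norm u + 1 > 0\<close> by (simp add: d_def field_simps)
    then show "norm u * d < e" using \<open>d > 0\<close> e by (simp add: algebra_simps)
  qed
  have "\<forall>\<^sub>F m in sequentially. (\<forall>x\<in>K m. \<exists>y\<in>M. dist x y \<le> d) \<and>
      (\<forall>y\<in>M. \<exists>x\<in>K m. dist x y \<le> d)"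
    using lim d(1) unfolding hausdorff_lim_iff[OF K M] by blast
  then show "\<forall>\<^sub>F m in sequentially. dist (supp (K m) u) (supp M u) < e"
  proof eventually_elim
    case (elim m)
    have "supp (K m) u \<le> supp M u + norm u * d"
      using elim by (intro le K M) auto
    moreover have "supp M u \<le> supp (K m) u + norm u * d"
      using elim by (intro le K M) (auto simp: dist_commute)
    ultimately show ?case using d(2) by (simp add: dist_real_def)
  qed
qed

section \<open>Zonotopes and zonoids\<close>

text \<open>The segments need not be centred, so the width \<open>supp Z u + supp Z (- u)\<close>
  replaces the support function: it ignores translations and is a sum of absolute values of linear
  forms.\<close>

lemma zonotope_sum_properties:
  fixes a b :: "nat \<Rightarrow> 'a::euclidean_space"
  defines "Z \<equiv> \<lambda>m. \<Sum>i<m. closed_segment (a i) (b i)"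
  shows "compact (Z m) \<and> Z m \<noteq> {} \<and> convex (Z m)
    \<and> supp (Z m) u + supp (Z m) (- u) = (\<Sum>i<m. \<bar>(a i - b i) \<bullet> u\<bar>)"
proof (induction m)
  case 0
  then show ?case by (simp add: Z_def supp_def set_zero)
next
  case (Suc m)
  have Z: "Z (Suc m) = Z m + closed_segment (a m) (b m)" by (simp add: Z_def)
  have "compact (Z (Suc m))"
    unfolding Z using Suc by (intro compact_set_plus) auto
  moreover have "Z (Suc m) \<noteq> {}"
    using Suc unfolding Z by (auto simp: set_plus_def)
  moreover have "convex (Z (Suc m))"
    unfolding Z using Suc by (intro convex_set_plus) auto
  moreover have "supp (Z (Suc m)) u + supp (Z (Suc m)) (- u)
      = supp (Z m) u + supp (Z m) (- u)
        + (max (u \<bullet> a m) (u \<bullet> b m) + max (- (u \<bullet> a m)) (- (u \<bullet> b m)))"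
    using Suc by (simp add: Z supp_plus supp_closed_segment)
  moreover have "max (u \<bullet> a m) (u \<bullet> b m) + max (- (u \<bullet> a m)) (- (u \<bullet> b m)) = \<bar>(a m - b m) \<bullet> u\<bar>"
    by (simp add: inner_diff_left inner_commute[of u] max_def abs_if)
  ultimately show ?case using Suc by simp
qed

lemma zonotopeD:
  fixes Z :: "'a::euclidean_space set"
  assumes "zonotope Z"
  shows "compact Z" "Z \<noteq> {}" "convex Z"
    and "\<exists>(m::nat) c. \<forall>u. supp Z u + supp Z (- u) = (\<Sum>i<m. \<bar>c i \<bullet> u\<bar>)"
proof -
  obtain m a b where Z: "Z = (\<Sum>i<m::nat. closed_segment (a i) (b i))"
    using assms unfolding zonotope_def by blast
  show "compact Z" "Z \<noteq> {}" "convex Z"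
    using zonotope_sum_properties[where a=a and b=b and m=m] unfolding Z by blast+
  show "\<exists>(m::nat) c. \<forall>u. supp Z u + supp Z (- u) = (\<Sum>i<m. \<bar>c i \<bullet> u\<bar>)"
    unfolding Z
    by (rule exI[of _ m], rule exI[of _ "\<lambda>i. a i - b i"])
      (use zonotope_sum_properties[where a=a and b=b and m=m] in blast)
qed

lemma zonotope_linear_image:
  assumes "linear g" "zonotope Z"
  shows "zonotope (g ` Z)"
proof -
  obtain m a b where Z: "Z = (\<Sum>i<m::nat. closed_segment (a i) (b i))"
    using assms(2) unfolding zonotope_def by blast
  have "g ` (\<Sum>i<m::nat. closed_segment (a i) (b i)) = (\<Sum>i<m. closed_segment (g (a i)) (g (b i)))"
    for m
    by (induction m)
      (simp_all add: set_zero linear_0[OF assms(1)] image_set_plus linear_add[OF assms(1)]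
        closed_segment_linear_image[OF assms(1)])
  then show ?thesis
    unfolding Z zonotope_def by (intro exI[of _ m] exI[of _ "\<lambda>i. g (a i)"] exI[of _ "\<lambda>i. g (b i)"])
qed

lemma zonotope_imp_zonoid:
  fixes Z :: "'a::euclidean_space set"
  assumes "zonotope Z"
  shows "zonoid Z"
proof -
  have "hausdorff_lim (\<lambda>_. Z) Z"
    using zonotopeD[OF assms] by (subst hausdorff_lim_iff)
        (force intro!: always_eventually)+
  then show ?thesis
    unfolding zonoid_def using zonotopeD[OF assms] assms by (intro conjI exI[of _ "\<lambda>_. Z"]) auto
qed

lemma sym_zonoidsD:
  fixes K :: "'a::euclidean_space set"
  assumes "K \<in> sym_zonoids"
  shows "compact K" "K \<noteq> {}" "convex K" "uminus ` K = K"
proof -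
  show K: "compact K" "K \<noteq> {}" "uminus ` K = K"
    using assms by (auto simp: sym_zonoids_def zonoid_def)
  obtain Z where "\<And>m. zonotope (Z m)" "hausdorff_lim Z K"
    using assms by (auto simp: sym_zonoids_def zonoid_def)
  then show "convex K"
    using K zonotopeD convex_hausdorff_lim by metis
qed

lemma sym_zonoids_linear_image:
  fixes K :: "'a::euclidean_space set" and g :: "'a \<Rightarrow> 'b::euclidean_space"
  assumes g: "linear g" and K: "K \<in> sym_zonoids"
  shows "g ` K \<in> sym_zonoids"
proof -
  note KD = sym_zonoidsD[OF K]
  obtain Z where Z: "\<And>m. zonotope (Z m)" "hausdorff_lim Z K"
    using K by (auto simp: sym_zonoids_def zonoid_def)
  have "hausdorff_lim (\<lambda>m. g ` Z m) (g ` K)"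
    using g KD Z zonotopeD by (intro hausdorff_lim_image) (auto simp: linear_conv_bounded_linear)
  moreover have "compact (g ` K)"
    using g KD by (intro compact_continuous_image linear_continuous_on)
      (auto simp: linear_conv_bounded_linear)
  moreover have "uminus ` g ` K = g ` uminus ` K"
    by (simp add: image_image linear_neg[OF g])
  ultimately show ?thesis
    using KD Z zonotope_linear_image[OF g]
    by (auto simp: sym_zonoids_def zonoid_def intro!: exI[of _ "\<lambda>m. g ` Z m"])
qed

section \<open>Symmetric segments and rank-one images\<close>

abbreviation sym_segment :: "'a::real_vector \<Rightarrow> 'a set" where
  "sym_segment a \<equiv> closed_segment (- a) a"

lemma supp_sym_segment: "supp (sym_segment a) u = \<bar>u \<bullet> a\<bar>"
  by (simp add: supp_closed_segment)

lemma sym_segment_sum_in_sym_zonoids: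
  fixes a :: "'a::euclidean_space"
  shows "sym_segment a + sym_segment b \<in> sym_zonoids"
proof -
  have *: "uminus ` sym_segment c = sym_segment c" for c :: 'a
    using closed_segment_linear_image[of uminus "- c" c]
    by (simp add: linear_uminus closed_segment_commute)
  have "uminus ` (sym_segment a + sym_segment b) = sym_segment a + sym_segment b"
    by (simp add: image_set_plus *)
  moreover have "sym_segment a + sym_segment b
      = (\<Sum>i<2::nat. closed_segment ([- a, - b] ! i) ([a, b] ! i))"
    by (simp add: numeral_2_eq_2)
  then have "zonotope (sym_segment a + sym_segment b)"
    unfolding zonotope_def by (intro exI[of _ 2] exI)
  ultimately show ?thesis
    by (simp add: sym_zonoids_def zonotope_imp_zonoid)
qed

lemma sym_segment_in_sym_zonoids:
  fixes a :: "'a::euclidean_space"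
  shows "sym_segment a \<in> sym_zonoids"
  using sym_segment_sum_in_sym_zonoids[of a 0] by (simp flip: set_zero)

text \<open>By symmetry and convexity, \<open>u \<bullet> x\<close> runs over the whole interval
  from \<open>- supp K u\<close> to \<open>supp K u\<close>. A rank-one map thus remembers only the
  number \<open>supp K u\<close>, which reduces an operation on zonoids to a function of two real
  variables.\<close>

lemma rank_one_image_sym_zonoid:
  fixes K :: "'a::euclidean_space set"
  assumes "K \<in> sym_zonoids"
  shows "(\<lambda>x. (u \<bullet> x) *\<^sub>R e) ` K = sym_segment (supp K u *\<^sub>R e)"
proof -
  note K = sym_zonoidsD[OF assms]
  obtain x where x: "x \<in> K" "supp K u = u \<bullet> x" "\<And>y. y \<in> K \<Longrightarrow> u \<bullet> y \<le> u \<bullet> x"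
    using supp_attained[OF K(1,2)] by metis
  have lin: "linear (\<lambda>x. (u \<bullet> x) *\<^sub>R e)"
    by (intro linearI) (simp_all add: inner_add_right scaleR_add_left)
  have uminus: "- y \<in> K" if "y \<in> K" for y using K(4) that by blast
  have "sym_segment (supp K u *\<^sub>R e) = (\<lambda>x. (u \<bullet> x) *\<^sub>R e) ` closed_segment (- x) x"
    by (simp add: closed_segment_linear_image[OF lin, symmetric] x(2))
  also have "\<dots> \<subseteq> (\<lambda>x. (u \<bullet> x) *\<^sub>R e) ` K"
    using K(3) x(1) uminus by (intro image_mono closed_segment_subset) auto
  finally have "sym_segment (supp K u *\<^sub>R e) \<subseteq> (\<lambda>x. (u \<bullet> x) *\<^sub>R e) ` K" .
  moreover have "(u \<bullet> y) *\<^sub>R e \<in> sym_segment (supp K u *\<^sub>R e)" if "y \<in> K" for y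
  proof -
    have "u \<bullet> y \<in> closed_segment (- (u \<bullet> x)) (u \<bullet> x)"
      using x(3)[OF that] x(3)[OF uminus[OF that]] by (auto simp: closed_segment_eq_real_ivl)
    then have "(u \<bullet> y) *\<^sub>R e \<in> (\<lambda>s. s *\<^sub>R e) ` closed_segment (- (u \<bullet> x)) (u \<bullet> x)" by blast
    also have "linear (\<lambda>s. s *\<^sub>R e)" by (intro linearI) (simp_all add: scaleR_add_left)
    then have "(\<lambda>s. s *\<^sub>R e) ` closed_segment (- (u \<bullet> x)) (u \<bullet> x) = sym_segment (supp K u *\<^sub>R e)"
      using closed_segment_linear_image[of "\<lambda>s. s *\<^sub>R e" "- (u \<bullet> x)" "u \<bullet> x"] by (simp add: x(2))
    finally show ?thesis .
  qed
  ultimately show ?thesis by blast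
qed

section \<open>Second differences of support functions\<close>

text \<open>The second difference of the absolute value at \<open>x\<close> with step
  \<open>y\<close> is twice the positive part of \<open>\<bar>y\<bar> - \<bar>x\<bar>\<close>, so it
  can grow only as \<open>\<bar>x\<bar>\<close> shrinks, and by at most twice the loss. The triangle
  inequality bounds the loss from \<open>t * (p - s * q)\<close> to \<open>t * (1 + s) * p\<close>
  by \<open>t * s * (\<bar>q\<bar> - \<bar>p\<bar>)\<close>, whose positive part, doubled, is the
  last term. The factor \<open>1 + s\<close> is chosen so that this bound vanishes for
  \<open>\<bar>p\<bar> = \<bar>q\<bar>\<close>.\<close>

lemma abs_second_difference_le:
  fixes p q r s t :: real
  assumes "s \<ge> 0" "t \<ge> 0"
  shows "\<bar>t * (1 + s) * p + r\<bar> + \<bar>t * (1 + s) * p - r\<bar> - 2 * \<bar>t * (1 + s) * p\<bar>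
    \<le> \<bar>t * (p - s * q) + r\<bar> + \<bar>t * (p - s * q) - r\<bar> - 2 * \<bar>t * (p - s * q)\<bar>
      + t * s * (\<bar>p + q\<bar> + \<bar>p - q\<bar> - 2 * \<bar>p\<bar>)"
proof -
  have D: "\<bar>x + y\<bar> + \<bar>x - y\<bar> - 2 * \<bar>x\<bar> = 2 * max 0 (\<bar>y\<bar> - \<bar>x\<bar>)" for x y :: real
    by (auto simp: abs_if max_def)
  have "\<bar>t * (p - s * q)\<bar> \<le> t * \<bar>p\<bar> + t * s * \<bar>q\<bar>"
    using abs_triangle_ineq4[of "t * p" "t * s * q"] assms by (simp add: abs_mult algebra_simps)
  moreover have "\<bar>t * (1 + s) * p\<bar> = t * \<bar>p\<bar> + t * s * \<bar>p\<bar>"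
  proof -
    have "\<bar>t * (1 + s) * p\<bar> = t * (1 + s) * \<bar>p\<bar>" using assms by (simp add: abs_mult)
    then show ?thesis by (simp add: algebra_simps)
  qed
  moreover define N where "N = t * s * max 0 (\<bar>q\<bar> - \<bar>p\<bar>)"
  have "t * s * (\<bar>q\<bar> - \<bar>p\<bar>) \<le> N" "0 \<le> N"
    unfolding N_def using assms by (auto intro: mult_left_mono)
  ultimately have N: "\<bar>t * (p - s * q)\<bar> - \<bar>t * (1 + s) * p\<bar> \<le> N" "0 \<le> N"
    by (simp_all add: right_diff_distrib)
  have "max 0 (\<bar>r\<bar> - x) \<le> max 0 (\<bar>r\<bar> - y) + N" if "y - x \<le> N" for x y
    using that N(2) by (simp add: max_def)
  from mult_left_mono[OF this[OF N(1)], of 2] show ?thesis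
    unfolding D N_def by (simp only: distrib_left mult.left_commute)
qed

text \<open>The inequality holds for \<open>\<bar>c \<bullet> _\<bar>\<close>, hence for sums of such functions and their limits. It
  replaces the generating measure of a zonoid: second differences far out along the ray through \<open>v\<close>
  measure the mass on the hyperplane orthogonal to \<open>v\<close>, and this mass is also orthogonal to
  \<open>v - s w\<close> except for the part not orthogonal to \<open>w\<close>, which is controlled by the last term.\<close>

lemma supp_second_difference_le:
  fixes K :: "'a::euclidean_space set"
  assumes K: "K \<in> sym_zonoids" and st: "s \<ge> 0" "t \<ge> 0"
  defines "h \<equiv> supp K" and "l \<equiv> t * (1 + s)"
  shows "h (l *\<^sub>R v + z) + h (l *\<^sub>R v - z) - 2 * h (l *\<^sub>R v)
    \<le> h (t *\<^sub>R (v - s *\<^sub>R w) + z) + h (t *\<^sub>R (v - s *\<^sub>R w) - z) - 2 * h (t *\<^sub>R (v - s *\<^sub>R w))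
      + t * s * (h (v + w) + h (v - w) - 2 * h v)"
proof -
  note KD = sym_zonoidsD[OF K]
  obtain Z where Z: "\<And>m. zonotope (Z m)" "hausdorff_lim Z K"
    using K by (auto simp: sym_zonoids_def zonoid_def)
  \<comment> \<open>The width of the approximating zonotopes, which need not be symmetric. It is a
    finite sum of terms \<open>\<bar>c \<bullet> u\<bar>\<close>, and it tends to
    \<open>2 * h u\<close> because the limit \<open>K\<close> is symmetric.\<close>
  define g where "g m u = supp (Z m) u + supp (Z m) (- u)" for m u
  have lim: "(\<lambda>m. g m u) \<longlonglongrightarrow> 2 * h u" for u
  proof -
    have "(\<lambda>m. g m u) \<longlonglongrightarrow> supp K u + supp K (- u)"
      unfolding g_def using Z zonotopeD KD by (intro tendsto_add tendsto_supp) auto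
    then show ?thesis by (simp add: supp_uminus[OF KD(4)] h_def)
  qed
  have le: "g m (l *\<^sub>R v + z) + g m (l *\<^sub>R v - z) - 2 * g m (l *\<^sub>R v)
    \<le> g m (t *\<^sub>R (v - s *\<^sub>R w) + z) + g m (t *\<^sub>R (v - s *\<^sub>R w) - z) - 2 * g m (t *\<^sub>R (v - s *\<^sub>R w))
      + t * s * (g m (v + w) + g m (v - w) - 2 * g m v)" for m
  proof -
    obtain k c where "\<And>u. g m u = (\<Sum>i<k::nat. \<bar>c i \<bullet> u\<bar>)"
      using zonotopeD(4)[OF Z(1)[of m]] unfolding g_def by blast
    then show ?thesis
      using sum_mono[where K="{..<k}", OF abs_second_difference_le[OF st,
            of "c i \<bullet> v" "c i \<bullet> z" "c i \<bullet> w" for i]]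
      by (simp add: l_def inner_add_right inner_diff_right sum.distrib sum_subtractf
          flip: sum_distrib_left)
  qed
  have "2 * h (l *\<^sub>R v + z) + 2 * h (l *\<^sub>R v - z) - 2 * (2 * h (l *\<^sub>R v))
    \<le> 2 * h (t *\<^sub>R (v - s *\<^sub>R w) + z) + 2 * h (t *\<^sub>R (v - s *\<^sub>R w) - z)
      - 2 * (2 * h (t *\<^sub>R (v - s *\<^sub>R w)))
      + t * s * (2 * h (v + w) + 2 * h (v - w) - 2 * (2 * h v))"
    by (rule lim_mono[where N=0, OF le]) (rule tendsto_intros lim)+
  then show ?thesis by (simp add: algebra_simps)
qed

section \<open>The rigidity argument for two-variable functions\<close>

text \<open>The increments of a bounded monotone sequence are summable, so they cannot eventually
  dominate a multiple of the harmonic series.\<close>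

lemma incseq_bounded_increments:
  fixes p :: "nat \<Rightarrow> real"
  assumes "incseq p" "\<And>n. p n \<le> C" "d > 0"
  shows "\<exists>n\<ge>N. real (Suc n) * (p (Suc n) - p n) < d"
proof (rule ccontr)
  assume neg: "\<not> ?thesis"
  have "convergent p"
    using assms(1,2) incseq_convergent[of p C] by (metis convergent_def)
  then obtain L where "p \<longlonglongrightarrow> L" by (auto simp: convergent_def)
  then have "summable (\<lambda>n. p (Suc n) - p n)"
    using telescope_sums by (blast intro: sums_summable)
  then have "summable (\<lambda>n. (p (Suc n) - p n) / d)"
    by (rule summable_divide)
  then have "summable (\<lambda>n. 1 / real (Suc n))"
  proof (rule summable_comparison_test'[where N=N])
    fix n assume "n \<ge> N"
    then have "d \<le> real (Suc n) * (p (Suc n) - p n)" using neg by force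
    then show "norm (1 / real (Suc n)) \<le> (p (Suc n) - p n) / d"
      using \<open>d > 0\<close> by (simp add: field_simps)
  qed
  then have "summable (\<lambda>n. 1 / real n)"
    using summable_Suc_iff[of "\<lambda>n. 1 / real n"] by simp
  then show False using not_summable_harmonic[where 'a=real] by (simp add: inverse_eq_divide)
qed

text \<open>\<open>F\<close> on the positive quadrant is the support function of the zonoid obtained
  from a square and a segment, restricted to the plane of \<open>e1\<close> and \<open>e3\<close>.
  The last assumption is \<open>supp_second_difference_le\<close> for
  \<open>v = s *\<^sub>R e1 + e3\<close>, \<open>w = e1\<close>, \<open>z = e2\<close>.\<close>

locale zonoid_gauge =
  fixes F :: "real \<Rightarrow> real \<Rightarrow> real"
  assumes hom: "\<And>c s t. c \<ge> 0 \<Longrightarrow> s \<ge> 0 \<Longrightarrow> t \<ge> 0 \<Longrightarrow> F (c * s) (c * t) = c * F s t"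
    and subadd: "\<And>s t s' t'. s \<ge> 0 \<Longrightarrow> t \<ge> 0 \<Longrightarrow> s' \<ge> 0 \<Longrightarrow> t' \<ge> 0 \<Longrightarrow>
      F (s + s') (t + t') \<le> F s t + F s' t'"
    and right_zero: "\<And>s. s \<ge> 0 \<Longrightarrow> F s 0 = s"
    and left_zero: "\<And>t. t \<ge> 0 \<Longrightarrow> F 0 t = t"
    and ge_left: "\<And>s t. s \<ge> 0 \<Longrightarrow> t \<ge> 0 \<Longrightarrow> s \<le> F s t"
    and second_difference: "\<And>s t. s \<ge> 1 \<Longrightarrow> t \<ge> 0 \<Longrightarrow>
      2 * (F (t * (1 + s) * s + 1) (t * (1 + s)) - F (t * (1 + s) * s) (t * (1 + s)))
      \<le> 2 * (F 1 t - t) + t * s * (F (s + 1) 1 + F (s - 1) 1 - 2 * F s 1)"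
begin

section \<open>Unit increments of the gauge in its first argument\<close>

lemma convex_left:
  assumes "s \<ge> 0" "s' \<ge> 0" "a \<ge> 0" "b \<ge> 0" "a + b = 1" "r \<ge> 0"
  shows "F (a * s + b * s') r \<le> a * F s r + b * F s' r"
  using subadd[of "a * s" "a * r" "b * s'" "b * r"] assms hom[of a s r] hom[of b s' r]
  by (simp flip: distrib_right)

text \<open>A difference quotient standing in for the partial derivative of \<open>F\<close> in its
  first argument along the line where the second is 1.\<close>

definition slope :: "nat \<Rightarrow> real" where
  "slope n = F (real (Suc n)) 1 - F (real n) 1"

lemma incseq_slope: "incseq slope"
proof (rule incseq_SucI)
  fix n
  show "slope n \<le> slope (Suc n)"
  proof -
    have "1/2 * real n + 1/2 * real (Suc (Suc n)) = real (Suc n)" by (simp add: field_simps)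
    then show ?thesis
      using convex_left[of "real n" "real (Suc (Suc n))" "1/2" "1/2" 1] by (simp add: slope_def)
  qed
qed

lemma sum_slope: "(\<Sum>i<n. slope i) = F (real n) 1 - 1"
  using sum_lessThan_telescope[of "\<lambda>i. F (real i) 1" n] left_zero[of 1] by (simp add: slope_def)

lemma slope_le_1: "slope n \<le> 1"
  using subadd[of "real n" 1 1 0] right_zero[of 1] by (simp add: slope_def add.commute)

text \<open>Since \<open>F n 1 \<ge> n\<close>, the first \<open>n\<close> slopes add up to at least
  \<open>n - 1\<close>, so they cannot all stay \<open>d\<close> below 1. Monotonicity keeps them
  near 1 afterwards.\<close>

lemma slope_near_1:
  assumes "d > 0"
  shows "\<exists>N. \<forall>n\<ge>N. slope n > 1 - d"
proof -
  have "\<exists>N. slope N > 1 - d"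
  proof (rule ccontr)
    assume "\<not> ?thesis"
    then have le: "slope i \<le> 1 - d" for i by (simp add: not_less)
    obtain n where n: "real n * d > 1" using reals_Archimedean3[OF assms] by blast
    have "real n - 1 \<le> (\<Sum>i<n. slope i)"
      using ge_left[of "real n" 1] by (simp add: sum_slope)
    also have "\<dots> \<le> real n * (1 - d)"
      using sum_mono[of "{..<n}" slope "\<lambda>_. 1 - d"] le by simp
    finally show False using n by (simp add: algebra_simps)
  qed
  then show ?thesis using incseqD[OF incseq_slope] by (meson less_le_trans)
qed

text \<open>By convexity the difference quotient on the unit interval to the left of
  \<open>Suc n\<close> is at most the one on the interval of length \<open>1/l\<close> to its right;
  homogeneity with factor \<open>l\<close> turns the latter into the right-hand side.\<close>

lemma slope_le_difference:
  assumes "l \<ge> 1"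
  shows "slope n \<le> F (l * real (Suc n) + 1) l - F (l * real (Suc n)) l"
proof -
  let ?s = "real (Suc n)"
  \<comment> \<open>The common endpoint as a convex combination of the two outer endpoints, with
    weights inverse to the distances \<open>1/l\<close> and 1.\<close>
  have "?s = (l / (l+1)) * (?s + 1/l) + (1/(l+1)) * (?s - 1)"
    using assms by (simp add: divide_simps) (simp add: algebra_simps)
  moreover have "F ((l / (l+1)) * (?s + 1/l) + (1/(l+1)) * (?s - 1)) 1
      \<le> (l / (l+1)) * F (?s + 1/l) 1 + (1/(l+1)) * F (?s - 1) 1"
    using assms by (intro convex_left) (auto simp: field_simps)
  ultimately have "F ?s 1 \<le> (l / (l+1)) * F (?s + 1/l) 1 + (1/(l+1)) * F (?s - 1) 1" by simp
  then have "(l+1) * F ?s 1 \<le> (l+1) * ((l / (l+1)) * F (?s + 1/l) 1 + (1/(l+1)) * F (?s - 1) 1)"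
    using assms by (intro mult_left_mono) auto
  also have "\<dots> = l * F (?s + 1/l) 1 + F (?s - 1) 1"
    using assms by (simp add: distrib_left)
  finally have "(l+1) * F ?s 1 \<le> l * F (?s + 1/l) 1 + F (?s - 1) 1" .
  moreover have "l * F (?s + 1/l) 1 = F (l * ?s + 1) l"
    using hom[of l "?s + 1/l" 1] assms by (simp add: distrib_left)
  moreover have "l * F ?s 1 = F (l * ?s) l"
    using hom[of l ?s 1] assms by simp
  ultimately show ?thesis by (simp add: slope_def algebra_simps)
qed

text \<open>Let \<open>s\<close> grow in \<open>second_difference\<close>: the left side is at least
  twice a slope near 1, and along suitable \<open>s\<close> the last term becomes small, leaving
  \<open>2 \<le> 2 * (F 1 t - t)\<close> in the limit.\<close>

lemma F_1_ge:
  assumes t: "t > 0"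
  shows "F 1 t \<ge> 1 + t"
proof (rule field_le_epsilon)
  fix d :: real assume d: "d > 0"
  have d': "d / 2 > 0" "d / t > 0" using d t by auto
  obtain N where N: "\<And>n. n \<ge> N \<Longrightarrow> slope n > 1 - d/2"
    using slope_near_1[OF d'(1)] by blast
  \<comment> \<open>Ensures \<open>l \<ge> 1\<close> below.\<close>
  obtain M where M: "real M * t > 1" using reals_Archimedean3[OF t] by blast
  \<comment> \<open>With \<open>s = Suc n\<close> the last term of \<open>second_difference\<close>
    is \<open>t * s * (slope (Suc n) - slope n)\<close>, hence below \<open>d\<close>.\<close>
  obtain n where n: "n \<ge> max N M" "real (Suc n) * (slope (Suc n) - slope n) < d / t"
    using incseq_bounded_increments[OF incseq_slope slope_le_1 d'(2)] by blast
  define s where "s = real (Suc n)"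
  define l where "l = t * (1 + s)"
  have "real M * t \<le> l"
    using n(1) t unfolding l_def s_def by (subst mult.commute) (intro mult_right_mono, auto)
  then have l: "l \<ge> 1" using M by linarith
  define D where "D = t * s * (F (s + 1) 1 + F (s - 1) 1 - 2 * F s 1)"
  define X where "X = F (l * s + 1) l - F (l * s) l"
  have "1 - d/2 < X"
    using N[of n] n(1) slope_le_difference[OF l, of n] unfolding X_def s_def by linarith
  moreover have "2 * X \<le> 2 * (F 1 t - t) + D"
    unfolding X_def l_def D_def using t by (intro second_difference) (auto simp: s_def)
  moreover have "D < d"
    using n(2) t by (simp add: D_def s_def slope_def field_simps)
  ultimately show "1 + t \<le> F 1 t + d" by (simp add: field_simps)
qed

text \<open>Homogeneity extends the lower bound \<open>F_1_ge\<close> to all positive arguments; the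
  upper bound is subadditivity along the axes.\<close>

theorem eq_add:
  assumes "s \<ge> 0" "t \<ge> 0"
  shows "F s t = s + t"
proof (cases "s = 0 \<or> t = 0")
  case True
  then show ?thesis using assms left_zero right_zero by auto
next
  case False
  then have "s > 0" "t > 0" using assms by auto
  then have "s * (1 + t/s) \<le> s * F 1 (t/s)"
    by (intro mult_left_mono F_1_ge) auto
  also have "\<dots> = F s t" using hom[of s 1 "t/s"] \<open>s > 0\<close> \<open>t > 0\<close> by simp
  finally have "s + t \<le> F s t" using \<open>s > 0\<close> by (simp add: distrib_left)
  then show ?thesis
    using subadd[of s 0 0 t] assms left_zero[of t] right_zero[of s] by simp
qed

end

section \<open>Reduction to support functions\<close>

lemma GL_covariant_op_linear:
  fixes g :: "real^'n \<Rightarrow> real^'n"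
  assumes "GL_covariant_op f" "linear g" "inj g" "K \<in> sym_zonoids" "L \<in> sym_zonoids"
  shows "g ` f K L = f (g ` K) (g ` L)"
proof -
  have g: "(*v) (matrix g) = g" using assms(2) by (simp add: matrix_vector_mul)
  have "invertible (matrix g)"
    using assms(3) by (simp add: invertible_left_inverse matrix_left_invertible_injective g)
  then show ?thesis using assms(1,4,5) g unfolding GL_covariant_op_def by metis
qed

lemma uniform_limit_rank_one:
  fixes u :: "'a::euclidean_space"
  assumes "bounded K"
  shows "uniform_limit K (\<lambda>m x. (u \<bullet> x) *\<^sub>R e + (1 / real (Suc m)) *\<^sub>R x) (\<lambda>x. (u \<bullet> x) *\<^sub>R e) sequentially"
proof (rule uniform_limitI)
  obtain B where B: "\<And>x. x \<in> K \<Longrightarrow> norm x \<le> B" "B > 0"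
    using assms by (auto simp: bounded_pos)
  fix d :: real assume "d > 0"
  then have "\<forall>\<^sub>F m in sequentially. 1 / real (Suc m) < d / B"
    using order_tendstoD(2)[OF LIMSEQ_inverse_real_of_nat, of "d / B"] B(2)
    by (simp add: inverse_eq_divide)
  then show "\<forall>\<^sub>F m in sequentially. \<forall>x\<in>K.
      dist ((u \<bullet> x) *\<^sub>R e + (1 / real (Suc m)) *\<^sub>R x) ((u \<bullet> x) *\<^sub>R e) < d"
  proof eventually_elim
    case (elim m)
    have "norm x / real (Suc m) < d" if "x \<in> K" for x
    proof -
      have "norm x * (1 / real (Suc m)) \<le> B * (1 / real (Suc m))"
        using B(1)[OF that] by (intro mult_right_mono) auto
      also have "\<dots> < B * (d / B)" using elim B(2) by (intro mult_strict_left_mono)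
      finally show ?thesis using B(2) by simp
    qed
    then show ?case by (simp add: dist_norm)
  qed
qed

text \<open>The rank-one map \<open>x \<mapsto> (u \<bullet> x) e\<close> is a limit of invertible maps, so continuity extends the
  covariance to it.\<close>

lemma supp_op_eq:
  fixes f :: "(real^'n) set \<Rightarrow> (real^'n) set \<Rightarrow> (real^'n) set"
  assumes closed: "\<And>K L. K \<in> sym_zonoids \<Longrightarrow> L \<in> sym_zonoids \<Longrightarrow> f K L \<in> sym_zonoids"
    and cont: "hausdorff_continuous_op f" and cov: "GL_covariant_op f"
    and K: "K \<in> sym_zonoids" and L: "L \<in> sym_zonoids" and e: "norm e = 1"
  shows "supp (f K L) u = supp (f (sym_segment (supp K u *\<^sub>R e)) (sym_segment (supp L u *\<^sub>R e))) e"
proof -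
  \<comment> \<open>The sign condition keeps the perturbed maps \<open>G m\<close> injective; the
    other sign follows by symmetry.\<close>
  have pos: "supp (f K L) u = supp (f (sym_segment (supp K u *\<^sub>R e)) (sym_segment (supp L u *\<^sub>R e))) e"
    if ue: "u \<bullet> e \<ge> 0" for u
  proof -
    define g where "g x = (u \<bullet> x) *\<^sub>R e" for x
    define G where "G m x = (u \<bullet> x) *\<^sub>R e + (1 / real (Suc m)) *\<^sub>R x" for m :: nat and x
    have ling: "linear g"
      unfolding g_def by (intro linearI) (simp_all add: inner_add_right scaleR_add_left)
    have linG: "linear (G m)" for m
      unfolding G_def
      by (intro linearI) (simp_all add: inner_add_right scaleR_add_left scaleR_add_right)
    have injG: "inj (G m)" for m
      unfolding linear_injective_0[OF linG]
    proof (intro allI impI)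
      fix x assume G0: "G m x = 0"
      \<comment> \<open>\<open>G m\<close> multiplies the functional \<open>u\<close> by a positive
        number, so its kernel lies in the hyperplane orthogonal to \<open>u\<close>, where
        \<open>G m\<close> is a nonzero multiple of the identity.\<close>
      have "u \<bullet> G m x = (u \<bullet> x) * (u \<bullet> e + 1 / real (Suc m))"
        by (simp add: G_def inner_add_right algebra_simps)
      moreover have "u \<bullet> e + 1 / real (Suc m) > 0" using ue by (simp add: add_nonneg_pos)
      ultimately have "u \<bullet> x = 0" using G0 by simp
      then show "x = 0" using G0 by (simp add: G_def)
    qed
    have lim: "hausdorff_lim (\<lambda>m. G m ` A) (g ` A)" if "A \<in> sym_zonoids" for A
      unfolding G_def g_def
      using sym_zonoidsD(1,2)[OF that] sym_zonoids_linear_image[OF linG that, THEN sym_zonoidsD(1)]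
        sym_zonoids_linear_image[OF ling that, THEN sym_zonoidsD(1)]
      by (intro hausdorff_lim_uniform uniform_limit_rank_one compact_imp_bounded)
        (simp_all add: G_def g_def)
    have cont': "hausdorff_lim (\<lambda>m. f (G m ` K) (G m ` L)) (f (g ` K) (g ` L))"
      using cont K L lim sym_zonoids_linear_image[OF ling] sym_zonoids_linear_image[OF linG]
      unfolding hausdorff_continuous_op_def by simp
    have im: "f (G m ` K) (G m ` L) = G m ` f K L" for m
      using GL_covariant_op_linear[OF cov linG injG K L] by simp
    have "(\<lambda>m. supp (G m ` f K L) e) \<longlonglongrightarrow> supp (f (g ` K) (g ` L)) e"
      using cont' closed K L sym_zonoids_linear_image[OF ling] sym_zonoids_linear_image[OF linG]
      unfolding im by (intro tendsto_supp) (auto dest: sym_zonoidsD intro: sym_zonoidsD(1))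
    moreover have "(\<lambda>m. supp (G m ` f K L) e) \<longlonglongrightarrow> supp (g ` f K L) e"
      using lim[OF closed[OF K L]] closed[OF K L] sym_zonoids_linear_image[OF ling]
        sym_zonoids_linear_image[OF linG]
      by (intro tendsto_supp) (auto dest: sym_zonoidsD intro: sym_zonoidsD(1))
    ultimately have "supp (g ` f K L) e = supp (f (g ` K) (g ` L)) e"
      using LIMSEQ_unique by blast
    \<comment> \<open>Holds because \<open>e \<bullet> g x = u \<bullet> x\<close> for the unit
      vector \<open>e\<close>.\<close>
    moreover have "supp (g ` A) e = supp A u" for A
      using e by (simp add: supp_def g_def image_image norm_eq_1)
    ultimately show ?thesis
      unfolding g_def rank_one_image_sym_zonoid[OF K] rank_one_image_sym_zonoid[OF L] by simp
  qed
  show ?thesis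
  proof (cases "u \<bullet> e \<ge> 0")
    case False
    \<comment> \<open>All sets involved are symmetric, so replacing \<open>u\<close> by
      \<open>- u\<close> changes no support value.\<close>
    then have "- u \<bullet> e \<ge> 0" by simp
    from pos[OF this] show ?thesis
      by (simp add: supp_uminus sym_zonoidsD(4) K L closed)
  qed (rule pos)
qed

text \<open>By \<open>supp_op_eq\<close> one function \<open>F\<close> governs all zonoids and all
  directions. It is therefore enough to determine \<open>F\<close> from a single well-chosen pair of
  bodies.\<close>

lemma supp_op_eq_add:
  fixes f :: "(real^'n) set \<Rightarrow> (real^'n) set \<Rightarrow> (real^'n) set"
  assumes card: "CARD('n) \<ge> 3"
    and closed: "\<And>K L. K \<in> sym_zonoids \<Longrightarrow> L \<in> sym_zonoids \<Longrightarrow> f K L \<in> sym_zonoids"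
    and cont: "hausdorff_continuous_op f" and cov: "GL_covariant_op f"
    and ident: "identity_property_op f"
    and K: "K \<in> sym_zonoids" and L: "L \<in> sym_zonoids"
  shows "supp (f K L) u = supp K u + supp L u"
proof -
  \<comment> \<open>Three dimensions are used: \<open>e1\<close> and \<open>e3\<close> carry the two
    arguments of \<open>F\<close>, and \<open>e2\<close> is the direction in which second
    differences are taken.\<close>
  obtain i j k :: 'n where ijk: "i \<noteq> j" "i \<noteq> k" "j \<noteq> k"
  proof -
    obtain T where "T \<subseteq> (UNIV :: 'n set)" "card T = 3"
      using obtain_subset_with_card_n[OF card] by metis
    then show thesis using that by (auto simp: card_3_iff)
  qed
  define e1 e2 e3 :: "real^'n" where "e1 = axis i 1" and "e2 = axis j 1" and "e3 = axis k 1"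
  have e [simp]: "e1 \<bullet> e1 = 1" "e2 \<bullet> e2 = 1" "e3 \<bullet> e3 = 1" "e1 \<bullet> e2 = 0" "e1 \<bullet> e3 = 0" "e2 \<bullet> e3 = 0"
      "e2 \<bullet> e1 = 0" "e3 \<bullet> e1 = 0" "e3 \<bullet> e2 = 0"
    using ijk by (simp_all add: e1_def e2_def e3_def inner_axis_axis)
  define F where "F s t = supp (f (sym_segment (s *\<^sub>R e1)) (sym_segment (t *\<^sub>R e1))) e1" for s t
  have F: "supp (f A B) v = F (supp A v) (supp B v)" if "A \<in> sym_zonoids" "B \<in> sym_zonoids" for A B v
    unfolding F_def by (rule supp_op_eq[OF closed cont cov that]) (simp_all add: norm_eq_1)
  \<comment> \<open>The square feeds \<open>e1\<close> and \<open>e2\<close> into the same argument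
    of \<open>F\<close>, so a step along \<open>e2\<close> changes the first argument of
    \<open>F\<close> while remaining orthogonal to the plane of \<open>e1\<close> and
    \<open>e3\<close>.\<close>
  define h where "h = supp (f (sym_segment e1 + sym_segment e2) (sym_segment e3))"
  have fz: "f (sym_segment e1 + sym_segment e2) (sym_segment e3) \<in> sym_zonoids"
    by (intro closed sym_segment_sum_in_sym_zonoids sym_segment_in_sym_zonoids)
  note fzD = sym_zonoidsD[OF fz]
  have h: "h v = F (\<bar>v \<bullet> e1\<bar> + \<bar>v \<bullet> e2\<bar>) \<bar>v \<bullet> e3\<bar>" for v
    unfolding h_def
    by (simp add: F sym_segment_sum_in_sym_zonoids sym_segment_in_sym_zonoids supp_plus
        supp_sym_segment)
  have hF: "h (a *\<^sub>R e1 + c *\<^sub>R e3) = F \<bar>a\<bar> \<bar>c\<bar>" for a c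
    by (simp add: h inner_add_left)
  have h_add_le: "h (v + w) \<le> h v + h w" for v w
    unfolding h_def by (rule supp_add_le[OF fzD(1,2)])
  interpret zonoid_gauge F
  proof
    show "F (c * s) (c * t) = c * F s t" if "c \<ge> 0" "s \<ge> 0" "t \<ge> 0" for c s t
    proof -
      have "h ((c * s) *\<^sub>R e1 + (c * t) *\<^sub>R e3) = c * h (s *\<^sub>R e1 + t *\<^sub>R e3)"
        using supp_scaleR[OF fzD(1,2) that(1), of "s *\<^sub>R e1 + t *\<^sub>R e3", folded h_def]
        by (simp add: scaleR_add_right)
      then show ?thesis using that unfolding hF by (simp add: abs_mult)
    qed
    show "F (s + s') (t + t') \<le> F s t + F s' t'" if "s \<ge> 0" "t \<ge> 0" "s' \<ge> 0" "t' \<ge> 0" for s t s' t'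
    proof -
      have "(s + s') *\<^sub>R e1 + (t + t') *\<^sub>R e3 = (s *\<^sub>R e1 + t *\<^sub>R e3) + (s' *\<^sub>R e1 + t' *\<^sub>R e3)"
        by (simp add: scaleR_add_left)
      then have "h ((s + s') *\<^sub>R e1 + (t + t') *\<^sub>R e3)
          \<le> h (s *\<^sub>R e1 + t *\<^sub>R e3) + h (s' *\<^sub>R e1 + t' *\<^sub>R e3)"
        by (simp only: h_add_le)
      then show ?thesis using that by (simp add: hF)
    qed
    \<comment> \<open>The segment with endpoint 0 is \<open>{0}\<close>, so the identity property
      applies.\<close>
    show right_zero: "F s 0 = s" if "s \<ge> 0" for s
      using ident sym_segment_in_sym_zonoids[of "s *\<^sub>R e1"] that
      by (simp add: F_def identity_property_op_def supp_closed_segment)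
    show "F 0 t = t" if "t \<ge> 0" for t
      using ident sym_segment_in_sym_zonoids[of "t *\<^sub>R e1"] that
      by (simp add: F_def identity_property_op_def supp_closed_segment)
    show "s \<le> F s t" if "s \<ge> 0" "t \<ge> 0" for s t
    proof -
      \<comment> \<open>\<open>h\<close> does not see the sign of the \<open>e3\<close> coordinate,
        so averaging a point with its reflection gives a point on the \<open>e1\<close> axis, where
        \<open>right_zero\<close> is available.\<close>
      have "(s *\<^sub>R e1 + t *\<^sub>R e3) + (s *\<^sub>R e1 + (- t) *\<^sub>R e3) = (2 * s) *\<^sub>R e1 + 0 *\<^sub>R e3"
        by (simp only: mult_2 scaleR_add_left) simp
      then have "h ((2 * s) *\<^sub>R e1 + 0 *\<^sub>R e3)
          \<le> h (s *\<^sub>R e1 + t *\<^sub>R e3) + h (s *\<^sub>R e1 + (- t) *\<^sub>R e3)"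
        by (metis h_add_le)
      then show ?thesis using that right_zero[of "2 * s"] unfolding hF by simp
    qed
    show "2 * (F (t * (1 + s) * s + 1) (t * (1 + s)) - F (t * (1 + s) * s) (t * (1 + s)))
      \<le> 2 * (F 1 t - t) + t * s * (F (s + 1) 1 + F (s - 1) 1 - 2 * F s 1)"
      if "s \<ge> 1" "t \<ge> 0" for s t
    proof -
      have "F 0 t = t"
        using ident sym_segment_in_sym_zonoids[of "t *\<^sub>R e1"] that
        by (simp add: F_def identity_property_op_def supp_closed_segment)
      moreover define l where "l = t * (1 + s)"
      then have "l \<ge> 0" using that by simp
      \<comment> \<open>The evaluation points for \<open>v = s *\<^sub>R e1 + e3\<close>,
        \<open>w = e1\<close>, \<open>z = e2\<close>: then \<open>v - s *\<^sub>R w\<close> is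
        \<open>e3\<close>, and \<open>s \<ge> 1\<close> turns \<open>\<bar>s - 1\<bar>\<close> into
        \<open>s - 1\<close>.\<close>
      have "h (l *\<^sub>R (s *\<^sub>R e1 + e3) + e2) = F (l * s + 1) l"
        "h (l *\<^sub>R (s *\<^sub>R e1 + e3) - e2) = F (l * s + 1) l"
        "h (l *\<^sub>R (s *\<^sub>R e1 + e3)) = F (l * s) l"
        using that \<open>l \<ge> 0\<close> unfolding h by (simp_all add: inner_add_left inner_diff_left abs_mult)
      moreover have "h (t *\<^sub>R (s *\<^sub>R e1 + e3 - s *\<^sub>R e1) + e2) = F 1 t"
        "h (t *\<^sub>R (s *\<^sub>R e1 + e3 - s *\<^sub>R e1) - e2) = F 1 t"
        "h (t *\<^sub>R (s *\<^sub>R e1 + e3 - s *\<^sub>R e1)) = F 0 t"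
        "h (s *\<^sub>R e1 + e3 + e1) = F (s + 1) 1" "h (s *\<^sub>R e1 + e3 - e1) = F (s - 1) 1"
        "h (s *\<^sub>R e1 + e3) = F s 1"
        using that unfolding h by (simp_all add: inner_add_left inner_diff_left)
      ultimately show ?thesis
        using supp_second_difference_le[OF fz, of s t "s *\<^sub>R e1 + e3" e2 e1, folded h_def l_def] that
        unfolding l_def by (simp only:) argo
    qed
  qed
  \<comment> \<open>By symmetry \<open>supp A u\<close> is half of
    \<open>supp A u + supp A (- u)\<close>, which is at least the value at 0. The formula of the
    gauge is available on the positive quadrant.\<close>
  have nonneg: "supp A u \<ge> 0" if "A \<in> sym_zonoids" for A :: "(real^'n) set"
  proof -
    note AD = sym_zonoidsD[OF that]
    show ?thesis
      using supp_add_le[OF AD(1,2), of u "- u"] supp_uminus[OF AD(4), of u]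
        supp_scaleR[OF AD(1,2), of 0 u] by simp
  qed
  show ?thesis by (simp add: F K L eq_add nonneg)
qed

theorem corollary5p2:
  fixes f :: "(real^'n) set \<Rightarrow> (real^'n) set \<Rightarrow> (real^'n) set"
  assumes "CARD('n) \<ge> 3"
    and "\<And>K L. K \<in> sym_zonoids \<Longrightarrow> L \<in> sym_zonoids \<Longrightarrow> f K L \<in> sym_zonoids"
  shows "hausdorff_continuous_op f \<and> GL_covariant_op f \<and> identity_property_op f \<longleftrightarrow>
    (\<forall>K\<in>sym_zonoids. \<forall>L\<in>sym_zonoids. f K L = K + L)"
proof (intro iffI ballI)
  fix K L :: "(real^'n) set"
  assume f: "hausdorff_continuous_op f \<and> GL_covariant_op f \<and> identity_property_op f"
    and KL: "K \<in> sym_zonoids" "L \<in> sym_zonoids"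
  note K = sym_zonoidsD[OF KL(1)] and L = sym_zonoidsD[OF KL(2)]
  note fKL = sym_zonoidsD[OF assms(2)[OF KL]]
  \<comment> \<open>Both sides are compact and convex, so equal support functions suffice.\<close>
  have supp: "supp (f K L) u = supp (K + L) u" for u
    using supp_op_eq_add[where f=f and u=u, OF assms _ _ _ KL] f K L by (simp add: supp_plus)
  have "compact (K + L)" using K L by (intro compact_set_plus)
  moreover have "K + L \<noteq> {}" using K(2) L(2) by (auto simp: set_plus_def)
  moreover have "convex (K + L)" using K L by (intro convex_set_plus)
  ultimately show "f K L = K + L"
    using fKL supp by (intro equalityI supp_subset) auto
next
  assume f: "\<forall>K\<in>sym_zonoids. \<forall>L\<in>sym_zonoids. f K L = K + L"
  \<comment> \<open>\<open>{0}\<close> is a degenerate symmetric segment.\<close>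
  have zero: "{0} \<in> (sym_zonoids :: (real^'n) set set)"
    using sym_segment_in_sym_zonoids[of "0 :: real^'n"] by simp
  have "hausdorff_continuous_op f"
    unfolding hausdorff_continuous_op_def
  proof (intro allI impI, elim conjE)
    fix K L :: "nat \<Rightarrow> (real^'n) set" and M N
    assume KL: "\<forall>m. K m \<in> sym_zonoids" "\<forall>m. L m \<in> sym_zonoids"
      and MN: "M \<in> sym_zonoids" "N \<in> sym_zonoids"
      and lim: "hausdorff_lim K M" "hausdorff_lim L N"
    have "hausdorff_lim (\<lambda>m. K m + L m) (M + N)"
      by (rule hausdorff_lim_plus[OF _ _ _ _ _ _ _ _ lim])
        (use KL MN sym_zonoidsD(1,2) in blast)+
    then show "hausdorff_lim (\<lambda>m. f (K m) (L m)) (f M N)"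
      using f KL MN by simp
  qed
  moreover have "GL_covariant_op f"
    unfolding GL_covariant_op_def
  proof (intro allI impI ballI)
    fix A :: "real^'n^'n" and K L :: "(real^'n) set"
    assume KL: "K \<in> sym_zonoids" "L \<in> sym_zonoids"
    have "(*v) A ` (K + L) = (*v) A ` K + (*v) A ` L"
      by (rule image_set_plus) (rule matrix_vector_right_distrib)
    then show "(*v) A ` f K L = f ((*v) A ` K) ((*v) A ` L)"
      using f KL sym_zonoids_linear_image[OF matrix_vector_mul_linear[of A]] by metis
  qed
  moreover have "identity_property_op f"
    using f zero by (auto simp: identity_property_op_def simp flip: set_zero)
  ultimately show "hausdorff_continuous_op f \<and> GL_covariant_op f \<and> identity_property_op f"
    by blast
qed

end
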